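(* Let $\mathcal F=\bigsqcup_{n\ge 0}\mathcal F_n\subseteq \mathbb P^*$ be a run-complete collection of words, where $\mathcal F_n$ (the set of words of length $n$ in $\mathcal F$) is finite for every $n\geq 0$. Then for any piecewise decreasing and connected dashed patterns $p_1,p_2,\ldots,p_m$, $$(p_1,p_2,\ldots,p_m)\ \overset{\mathcal F}{\sim_{*}}\ (\mathrm R\,p_1,\mathrm R\,p_2,\ldots,\mathrm R\,p_m).$$ In particular, for each $i$ and each integer $n\geq 0$, the joint distribution of the pair of statistics $(p_i,\mathrm R\,p_i)$ over $\mathcal F_n$ is symmetric (i.e. $(p_i,\mathrm R\,p_i)$ and $(\mathrm R\,p_i,p_i)$ have the same joint distribution over $\mathcal F_n$). If, in addition, $\mathcal F$ is reverse-complete, then $$(p_1,p_2,\ldots,p_m)\ \overset{\mathcal F}{\sim_{*}}\ (\langle \mathbf r|p_1\rangle,\langle \mathbf r|p_2\rangle,\ldots,\langle \mathbf r|p_m\rangle).$$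
   Context: $\mathbb P$ is the set of positive integers and $\mathbb P^*$ the free monoid of finite words over $\mathbb P$. A dashed pattern $p$ of length $m$ is a word of length $m$ in $\mathbb P^*$ whose set of letters is exactly $\{1,\dots,r\}$ for some $r\ge 1$, in which two adjacent letters may or may not be separated by a dash; it is written $p=\tau^{(1)}-\tau^{(2)}-\cdots-\tau^{(\ell)}$, where the $\tau^{(i)}$ are nonempty dash-free words. An occurrence of $p=p_1\cdots p_m$ (dashes omitted) in a word $w=w_1\cdots w_n\in\mathbb P^*$ is a choice of positions $1\le i_1<\dots<i_m\le n$ such that $w_{i_s}>w_{i_t}$ if and only if $p_s>p_t$ for all $1\le s,t\le m$, and $i_{s+1}=i_s+1$ whenever $p_s$ and $p_{s+1}$ are not separated by a dash in $p$. The statistic $(p)$ sends $w$ to its number of occurrences of $p$, and $(p_1,\ldots,p_m)$ is the vector statistic whose $i$-th coordinate is the number of occurrences of the pattern $p_i$. For nonempty words $w,w'\in\mathbb P^*$, $w$ is below $w'$ if every letter of $w$ is smaller than every letter of $w'$; write $w\ll w'$ if $w=w'$ or $w$ is below $w'$. The words $w,w'$ are comparable if $w\ll w'$ or $w'\ll w$, and incomparable otherwise. A dashed pattern $\tau^{(1)}-\cdots-\tau^{(\ell)}$ is connected if for each $i=1,\ldots,\ell-1$ the words $\tau^{(i)}$ and $\tau^{(i+1)}$ are incomparable or equal; it is piecewise decreasing if each $\tau^{(i)}$ is strictly decreasing. For a word $w$, $\mathbf r\,w$ is the reversed word. For $p=\tau^{(1)}-\tau^{(2)}-\cdots-\tau^{(\ell)}$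 put $\mathrm R\,p=\tau^{(\ell)}-\tau^{(\ell-1)}-\cdots-\tau^{(1)}$ and $\langle\mathbf r|p\rangle=\mathbf r\tau^{(1)}-\mathbf r\tau^{(2)}-\cdots-\mathbf r\tau^{(\ell)}$. The descending runs of a word are its maximal contiguous strictly decreasing subsequences. For a finite multiset $\mathcal M=\{D_1,\ldots,D_r\}$ of (nonempty, finite, strictly) decreasing sequences of positive integers, $\mathcal W(\mathcal M)$ is the set of words in $\mathbb P^*$ whose multiset of descending runs is $\mathcal M$. A collection $\mathcal F\subseteq\mathbb P^*$ is run-complete if for every such $\mathcal M$ either $\mathcal W(\mathcal M)\subseteq\mathcal F$ or $\mathcal W(\mathcal M)\cap\mathcal F=\emptyset$; it is reverse-complete if $\mathbf r\,w\in\mathcal F$ whenever $w\in\mathcal F$. $(p_1,\ldots,p_m)\overset{\mathcal F}{\sim_*}(q_1,\ldots,q_m)$ means: for every $n\ge0$ the vector statistics $(p_1,\ldots,p_m)$ and $(q_1,\ldots,q_m)$ have the same (joint) distribution over $\mathcal F_n$, i.e. for all $k_1,\ldots,k_m\ge 0$ the number of $w\in\mathcal F_n$ with exactly $k_i$ occurrences of $p_i$ for all $i$ equals the number of $w\in\mathcal F_n$ with exactly $k_i$ occurrences of $q_i$ for all $i$. *)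

theory Defs
  imports "HOL-Library.Multiset"
begin

definition pos_words :: "nat list set" where
  "pos_words = lists {1..}"

section \<open>Dashed patterns\<close>

text \<open>A dashed pattern is represented by the list of its dash-free blocks;
  its underlying word is the concatenation of the blocks.\<close>

type_synonym dpattern = "nat list list"

definition dashed_pattern :: "dpattern \<Rightarrow> bool" where
  "dashed_pattern p \<longleftrightarrow>
     [] \<notin> set p \<and> (\<exists>r\<ge>1. set (concat p) = {1..r})"

text \<open>Indices into words and patterns start at 0; the following says that the letters of
  \<open>concat p\<close> with indices \<open>s\<close> and \<open>Suc s\<close> are separated by a dash.\<close>

definition dash_after :: "dpattern \<Rightarrow> nat \<Rightarrow> bool" where
  "dash_after p s \<longleftrightarrow> (\<exists>k. 0 < k \<and> k < length p \<and> Suc s = length (concat (take k p)))"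

definition occurrences :: "dpattern \<Rightarrow> nat list \<Rightarrow> nat list set" where
  "occurrences p w = {is.
     length is = length (concat p) \<and>
     sorted_wrt (<) is \<and>
     set is \<subseteq> {..<length w} \<and>
     (\<forall>s<length is. \<forall>t<length is.
        w ! (is ! s) > w ! (is ! t) \<longleftrightarrow> concat p ! s > concat p ! t) \<and>
     (\<forall>s. Suc s < length is \<and> \<not> dash_after p s \<longrightarrow> is ! Suc s = Suc (is ! s))}"

definition occ :: "dpattern \<Rightarrow> nat list \<Rightarrow> nat" where
  "occ p w = card (occurrences p w)"

definition vec_occ :: "dpattern list \<Rightarrow> nat list \<Rightarrow> nat list" where
  "vec_occ ps w = map (\<lambda>p. occ p w) ps"

definition below :: "nat list \<Rightarrow> nat list \<Rightarrow> bool" where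
  "below u v \<longleftrightarrow> (\<forall>a\<in>set u. \<forall>b\<in>set v. a < b)"

definition below_eq :: "nat list \<Rightarrow> nat list \<Rightarrow> bool" where
  "below_eq u v \<longleftrightarrow> u = v \<or> below u v"

definition comparable :: "nat list \<Rightarrow> nat list \<Rightarrow> bool" where
  "comparable u v \<longleftrightarrow> below_eq u v \<or> below_eq v u"

definition connected_pattern :: "dpattern \<Rightarrow> bool" where
  "connected_pattern p \<longleftrightarrow>
     (\<forall>i. Suc i < length p \<longrightarrow> \<not> comparable (p ! i) (p ! Suc i) \<or> p ! i = p ! Suc i)"

abbreviation decreasing :: "nat list \<Rightarrow> bool" where
  "decreasing \<equiv> sorted_wrt (>)"

definition piecewise_decreasing :: "dpattern \<Rightarrow> bool" where
  "piecewise_decreasing p \<longleftrightarrow> (\<forall>\<tau>\<in>set p. decreasing \<tau>)"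

definition reverse_blocks :: "dpattern \<Rightarrow> dpattern" where
  "reverse_blocks p = rev p"

definition reverse_within_blocks :: "dpattern \<Rightarrow> dpattern" where
  "reverse_within_blocks p = map rev p"

section \<open>Descending runs and collections of words\<close>

definition factor :: "nat list \<Rightarrow> nat \<Rightarrow> nat \<Rightarrow> nat list" where
  "factor w i j = take (j - i) (drop i w)"

text \<open>Runs are located by half-open index intervals \<open>[i, j)\<close>, so that equal runs at
  different places are counted with multiplicity.\<close>

definition run_intervals :: "nat list \<Rightarrow> (nat \<times> nat) set" where
  "run_intervals w = {(i, j).
     i < j \<and> j \<le> length w \<and> decreasing (factor w i j) \<and>
     (\<forall>i' j'. i' \<le> i \<and> j \<le> j' \<and> j' \<le> length w \<and> decreasing (factor w i' j')
        \<longrightarrow> i' = i \<and> j' = j)}"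

definition descending_runs :: "nat list \<Rightarrow> nat list multiset" where
  "descending_runs w = image_mset (\<lambda>(i, j). factor w i j) (mset_set (run_intervals w))"

definition words_with_runs :: "nat list multiset \<Rightarrow> nat list set" where
  "words_with_runs M = {w \<in> pos_words. descending_runs w = M}"

definition run_complete :: "nat list set \<Rightarrow> bool" where
  "run_complete F \<longleftrightarrow>
     (\<forall>M. (\<forall>D\<in>#M. D \<noteq> [] \<and> D \<in> pos_words \<and> decreasing D) \<longrightarrow>
        words_with_runs M \<subseteq> F \<or> words_with_runs M \<inter> F = {})"

definition reverse_complete :: "nat list set \<Rightarrow> bool" where
  "reverse_complete F \<longleftrightarrow> (\<forall>w\<in>F. rev w \<in> F)"

definition of_length :: "nat list set \<Rightarrow> nat \<Rightarrow> nat list set" where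
  "of_length F n = {w \<in> F. length w = n}"

section \<open>Equidistribution\<close>

text \<open>Meaningful for finite \<open>A\<close> only, since \<open>card\<close> is 0 on infinite sets.\<close>

definition same_distribution ::
    "nat list set \<Rightarrow> (nat list \<Rightarrow> 'b) \<Rightarrow> (nat list \<Rightarrow> 'b) \<Rightarrow> bool" where
  "same_distribution A f g \<longleftrightarrow> (\<forall>k. card {w \<in> A. f w = k} = card {w \<in> A. g w = k})"

definition equidistributed_on ::
    "nat list set \<Rightarrow> dpattern list \<Rightarrow> dpattern list \<Rightarrow> bool" where
  "equidistributed_on F ps qs \<longleftrightarrow>
     (\<forall>n. same_distribution (of_length F n) (vec_occ ps) (vec_occ qs))"

end

theory Submission
  imports Defs "HOL-Library.Sublist"
begin

text \<open>
  Read a word as the sequence of its descending runs and let two distinct runs commute when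
  one lies below the other. Every commutation class of sequences of runs contains exactly one
  sequence without a run followed by a run below it, and these sequences are exactly the run
  decompositions of words. Reversing the sequence and passing to the representative of its class
  is therefore an involution \<open>mirror\<close> on the words with a given multiset of runs.
  The blocks of an occurrence of a connected piecewise decreasing pattern lie in different runs,
  and consecutive blocks lie in runs that are equal or do not commute; so the number of
  occurrences depends only on the commutation class, and \<open>mirror\<close> exchanges \<open>p\<close> with \<open>R p\<close>.
  The last claim follows because reversing a word turns \<open>R p\<close> into \<open>\<langle>r|p\<rangle>\<close>.
\<close>

section \<open>Commutation of runs\<close>

text \<open>For nonempty words this means incomparable or equal, the relation that connectedness
  imposes on consecutive blocks; for runs it says that they do not commute.\<close>

definition overlap :: "nat list \<Rightarrow> nat list \<Rightarrow> bool" where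
  "overlap u v \<longleftrightarrow> \<not> below u v \<and> \<not> below v u"

abbreviation normal :: "nat list list \<Rightarrow> bool" where
  "normal \<equiv> successively (\<lambda>D E. \<not> below E D)"

lemma overlap_self: "u \<noteq> [] \<Longrightarrow> overlap u u"
  by (cases u) (auto simp: overlap_def below_def)

lemma below_trans: "below u v \<Longrightarrow> below v w \<Longrightarrow> v \<noteq> [] \<Longrightarrow> below u w"
  by (cases v) (force simp: below_def)+

lemma below_asym: "below u v \<Longrightarrow> u \<noteq> [] \<Longrightarrow> v \<noteq> [] \<Longrightarrow> \<not> below v u"
  by (cases u; cases v) (force simp: below_def)+

lemma below_mono: "below u v \<Longrightarrow> set u' \<subseteq> set u \<Longrightarrow> set v' \<subseteq> set v \<Longrightarrow> below u' v'"
  unfolding below_def by blast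

section \<open>Normal forms by insertion of runs\<close>

fun insert_run :: "nat list \<Rightarrow> nat list list \<Rightarrow> nat list list" where
  "insert_run D [] = [D]"
| "insert_run D (E # es) = (if below E D then E # insert_run D es else D # E # es)"

definition normalize :: "nat list list \<Rightarrow> nat list list" where
  "normalize ds = foldr insert_run ds []"

lemma mset_insert_run: "mset (insert_run D es) = add_mset D (mset es)"
  by (induction es) auto

lemma mset_normalize: "mset (normalize ds) = mset ds"
  unfolding normalize_def by (induction ds) (auto simp: mset_insert_run)

lemma set_normalize: "set (normalize ds) = set ds"
  by (metis mset_normalize set_mset_mset)

lemma normal_insert_run:
  assumes "normal es" "[] \<notin> set es" "D \<noteq> []"
  shows "normal (insert_run D es)"
  using assms
proof (induction es)
  case (Cons E es)
  \<comment> \<open>The successor of \<open>E\<close> becomes \<open>D\<close> or stays the old one;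
    asymmetry handles the first case and normality the second.\<close>
  have "\<not> below (hd (insert_run D es)) E" if "below E D"
  proof (cases es)
    case Nil
    then show ?thesis using below_asym[OF that] Cons.prems by auto
  next
    case (Cons F fs)
    then show ?thesis using below_asym[OF that] Cons.prems by auto
  qed
  then show ?case using Cons by (auto simp: successively_Cons)
qed simp

lemma normal_normalize: "[] \<notin> set ds \<Longrightarrow> normal (normalize ds)"
proof (induction ds)
  case (Cons D ds)
  then show ?case
    using normal_insert_run[of "normalize ds" D] set_normalize[of ds] by (auto simp: normalize_def)
qed (simp add: normalize_def)

text \<open>A run is only moved past runs that lie below it, and of two overlapping runs neither is
  below the other; so \<open>X\<close> and \<open>Y\<close> are never exchanged.\<close>

lemma filter_insert_run:
  assumes "overlap X Y"
  shows "filter (\<lambda>Z. Z = X \<or> Z = Y) (insert_run D es) = filter (\<lambda>Z. Z = X \<or> Z = Y) (D # es)"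
  using assms by (induction es) (auto simp: overlap_def)

lemma filter_normalize:
  assumes "overlap X Y"
  shows "filter (\<lambda>Z. Z = X \<or> Z = Y) (normalize ds) = filter (\<lambda>Z. Z = X \<or> Z = Y) ds"
  unfolding normalize_def
  by (induction ds) (simp_all add: filter_insert_run[OF assms])

section \<open>Uniqueness of the normal form\<close>

lemma normal_all_below:
  assumes "normal (xs @ [D])" "[] \<notin> set xs" "D \<noteq> []" "\<And>X. X \<in> set xs \<Longrightarrow> \<not> overlap X D"
  shows "\<forall>X\<in>set xs. below X D"
  using assms
proof (induction xs)
  case (Cons X xs)
  then have IH: "\<forall>Y\<in>set xs. below Y D" by (auto simp: successively_Cons)
  \<comment> \<open>Being below \<open>D\<close> spreads leftwards: the successor \<open>Y\<close>
    of \<open>X\<close> is below \<open>D\<close>, so \<open>D\<close> below \<open>X\<close> would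
    put \<open>Y\<close> below \<open>X\<close>, against normality.\<close>
  have "\<not> below D X"
  proof (cases xs)
    case Nil
    then show ?thesis using Cons.prems by auto
  next
    case (Cons Y ys)
    then show ?thesis using Cons.prems IH below_trans[of Y D X] \<open>normal ((X # xs) @ [D])\<close> by auto
  qed
  then show ?case using Cons.prems(4)[of X] IH by (auto simp: overlap_def)
qed simp

text \<open>Look at the first \<open>D\<close> in \<open>E # es\<close>. No run before it overlaps
  \<open>D\<close>, because the projection to that pair starts with \<open>D\<close> on the other
  side. Normality then puts all these runs, \<open>E\<close> among them, below
  \<open>D\<close>.\<close>

lemma normal_head_below:
  assumes "normal (E # es)" "[] \<notin> set (E # es)" "D \<noteq> []" "D \<noteq> E"
    and proj: "\<And>X Y. overlap X Y \<Longrightarrow>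
      filter (\<lambda>Z. Z = X \<or> Z = Y) (D # ds) = filter (\<lambda>Z. Z = X \<or> Z = Y) (E # es)"
  shows "below E D"
proof -
  have "D \<in> set (filter (\<lambda>Z. Z = D \<or> Z = D) (E # es))"
    by (subst proj[symmetric]) (auto simp: overlap_self assms)
  then have "D \<in> set es" using assms(4) by auto
  then obtain xs bs where es: "es = xs @ D # bs" "D \<notin> set xs"
    by (meson split_list_first)
  have no: "\<not> overlap X D" if X: "X \<in> set (E # xs)" for X
  proof
    assume "overlap X D"
    from proj[OF this]
    have eq: "D # filter (\<lambda>Z. Z = X \<or> Z = D) ds =
        filter (\<lambda>Z. Z = X \<or> Z = D) (E # xs) @ filter (\<lambda>Z. Z = X \<or> Z = D) (D # bs)"
      using es by auto
    have "filter (\<lambda>Z. Z = X \<or> Z = D) (E # xs) \<noteq> []"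
      using X by (auto simp: filter_empty_conv)
    then have "D \<in> set (filter (\<lambda>Z. Z = X \<or> Z = D) (E # xs))"
      using eq by (cases "filter (\<lambda>Z. Z = X \<or> Z = D) (E # xs)") (simp_all only: append_Cons list.inject list.set_intros simp_thms)
    then show False using es assms(4) by (auto split: if_splits)
  qed
  have "normal (((E # xs) @ [D]) @ bs)" using assms(1) es by simp
  then have "normal ((E # xs) @ [D])" by (simp only: successively_append_iff)
  from normal_all_below[OF this _ assms(3) no] show ?thesis using assms(2) es by auto
qed

text \<open>Commutation classes are encoded by their projections to pairs of letters that do not
  commute: the projections determine the class, which avoids a closure of swaps.\<close>

lemma normal_unique:
  assumes "normal ds" "normal es" "[] \<notin> set ds" "[] \<notin> set es"
    and "\<And>X Y. overlap X Y \<Longrightarrow>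
      filter (\<lambda>Z. Z = X \<or> Z = Y) ds = filter (\<lambda>Z. Z = X \<or> Z = Y) es"
  shows "ds = es"
  using assms
proof (induction ds arbitrary: es)
  case Nil
  show ?case
  proof (cases es)
    case (Cons E es')
    then have "overlap E E" using Nil(4) overlap_self by auto
    from Nil(5)[OF this] show ?thesis using Cons by simp
  qed simp
next
  case (Cons D ds)
  obtain E es' where es: "es = E # es'"
    using Cons.prems(3) Cons.prems(5)[of D D, OF overlap_self]
    by (cases es) auto
  \<comment> \<open>Distinct heads would lie below each other, since
    \<open>normal_head_below\<close> applies in both directions.\<close>
  have "D = E"
  proof (rule ccontr)
    assume ne: "D \<noteq> E"
    have "below E D"
      by (rule normal_head_below[of E es' D ds]) (use Cons.prems es ne in auto)
    moreover have "below D E"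
      by (rule normal_head_below[of D ds E es']) (use Cons.prems es ne in auto)
    ultimately show False using below_asym Cons.prems es by auto
  qed
  moreover have "ds = es'"
  proof (rule Cons.IH)
    fix X Y assume "overlap X Y"
    from Cons.prems(5)[OF this]
    show "filter (\<lambda>Z. Z = X \<or> Z = Y) ds = filter (\<lambda>Z. Z = X \<or> Z = Y) es'"
      using es \<open>D = E\<close> by (auto split: if_splits)
  qed (use Cons.prems es in \<open>auto simp: successively_Cons\<close>)
  ultimately show ?case using es by simp
qed

text \<open>Both sides are normal. Normalization keeps the projections and the two reversals cancel
  in each of them, so uniqueness applies.\<close>

lemma normalize_rev_normalize_rev:
  assumes "normal ds" "[] \<notin> set ds"
  shows "normalize (rev (normalize (rev ds))) = ds"
proof (rule normal_unique)
  show "normal (normalize (rev (normalize (rev ds))))"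
    by (rule normal_normalize) (simp add: set_normalize assms)
qed (simp_all add: assms set_normalize filter_normalize rev_filter[symmetric])

section \<open>Counting occurrences of a sequence of blocks\<close>

text \<open>Counts the ways to find the blocks in runs with strictly increasing indices. A block occurs
  at most once in a run, because runs are strictly decreasing.\<close>

fun chains :: "nat list list \<Rightarrow> nat list list \<Rightarrow> nat" where
  "chains [] ds = 1"
| "chains (u # us) [] = 0"
| "chains (u # us) (D # ds) = of_bool (sublist u D) * chains us ds + chains (u # us) ds"

text \<open>The two orders differ only in chains that put consecutive blocks \<open>u\<close> and
  \<open>v\<close> into \<open>D\<close> and \<open>E\<close>. Such blocks overlap, whereas factors
  of \<open>D\<close> and \<open>E\<close> lie one below the other, so there are no such
  chains.\<close>

lemma chains_swap:
  assumes "successively overlap us" "\<not> overlap D E"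
  shows "chains us (D # E # ds) = chains us (E # D # ds)"
\<comment> \<open>The rule only separates zero, one and at least two blocks.\<close>
proof (cases us rule: remdups_adj.cases)
  case (3 u v us')
  have "\<not> below u v" "\<not> below v u" "below D E \<or> below E D"
    using assms 3 by (auto simp: overlap_def)
  then have "\<not> (sublist u D \<and> sublist v E)" "\<not> (sublist u E \<and> sublist v D)"
    using below_mono set_mono_sublist by blast+
  then show ?thesis using 3 by auto
qed auto

lemma chains_insert_run:
  assumes "successively overlap us"
  shows "chains us (insert_run D es) = chains us (D # es)"
  using assms
proof (induction es arbitrary: us)
  case (Cons E es)
  show ?case
  proof (cases "below E D")
    case True
    have "chains us (insert_run D (E # es)) = chains us (E # D # es)"
      using True Cons by (cases us) (auto simp: successively_Cons)
    also have "\<dots> = chains us (D # E # es)"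
      using True Cons.prems by (intro chains_swap) (auto simp: overlap_def)
    finally show ?thesis .
  qed simp
qed simp

lemma chains_normalize:
  assumes "successively overlap us"
  shows "chains us (normalize ds) = chains us ds"
  using assms
proof (induction ds arbitrary: us)
  case (Cons D ds)
  have "chains us (normalize (D # ds)) = chains us (D # normalize ds)"
    using chains_insert_run[OF Cons.prems] by (simp add: normalize_def)
  also have "\<dots> = chains us (D # ds)"
    using Cons by (cases us) (auto simp: successively_Cons)
  finally show ?case .
qed (simp add: normalize_def)

text \<open>The recursion of \<open>chains\<close> read at the right end, from which its symmetry
  under reversal follows.\<close>

lemma chains_snoc:
  "chains (us @ [u]) (ds @ [D]) = of_bool (sublist u D) * chains us ds + chains (us @ [u]) ds"
proof (induction ds arbitrary: us)
  case Nil
  show ?case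
  proof (cases us)
    case (Cons v vs)
    then show ?thesis by (cases vs) auto
  qed simp
next
  case (Cons E ds)
  note IH = Cons
  show ?case
  proof (cases us)
    case Nil
    then show ?thesis using IH[of "[]"] by simp
  next
    case (Cons v vs)
    then show ?thesis using IH[of vs] IH[of us] by (simp add: algebra_simps)
  qed
qed

lemma chains_rev: "chains (rev us) (rev ds) = chains us ds"
proof (induction us ds rule: chains.induct)
  case (2 u us)
  then show ?case by (cases "rev us") auto
next
  case (3 u us D ds)
  then show ?case by (simp add: chains_snoc)
qed simp

text \<open>Counterpart of \<open>chains\<close> on letters: the blocks are found from left to right
  as disjoint factors. The value 0 on the empty word is the correct count only for nonempty
  blocks.\<close>

fun placements :: "nat list list \<Rightarrow> nat list \<Rightarrow> nat" where
  "placements [] w = 1"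
| "placements (u # us) [] = 0"
| "placements (u # us) (x # w) =
     (if prefix u (x # w) then placements us (drop (length u) (x # w)) else 0)
     + placements (u # us) w"

section \<open>Blocks inside the descending runs of a word\<close>

lemma prefix_run:
  assumes "decreasing u" "prefix u (D @ w)" "D \<noteq> []" "w = [] \<or> last D \<le> hd w"
  shows "prefix u D"
proof (rule ccontr)
  \<comment> \<open>Otherwise \<open>u\<close> continues beyond the run, and the step from
    \<open>last D\<close> to \<open>hd w\<close> would be a descent.\<close>
  assume "\<not> prefix u D"
  then obtain v where v: "u = D @ v" "prefix v w" "v \<noteq> []"
    using assms(2) by (auto simp: prefix_append)
  then have "hd v = hd w" "w \<noteq> []" by (auto simp: prefix_def)
  moreover have "last D > hd v"
    using assms(1,3) v by (auto simp: sorted_wrt_append)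
  ultimately show False using assms(4) by auto
qed

text \<open>By \<open>prefix_run\<close> no placement of \<open>u\<close> starts inside
  \<open>D\<close>. The alternative \<open>D = []\<close> arises because the induction shortens the
  run letter by letter.\<close>

lemma placements_skip:
  assumes "decreasing D" "D = [] \<or> w = [] \<or> last D \<le> hd w"
    and "decreasing u" "\<not> sublist u D"
  shows "placements (u # us) (D @ w) = placements (u # us) w"
  using assms
proof (induction D)
  case (Cons x D)
  have "\<not> prefix u ((x # D) @ w)"
    using prefix_run[of u "x # D" w] Cons.prems by auto
  moreover have "placements (u # us) (D @ w) = placements (u # us) w"
    by (rule Cons.IH) (use Cons.prems in \<open>auto simp: sublist_Cons_right\<close>)
  ultimately show ?case by simp
qed simp

text \<open>This is the recursion of \<open>chains\<close>: the first block lies in \<open>D\<close>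
  or behind it, and once it lies in \<open>D\<close> the next block cannot, since the letters left
  over in \<open>D\<close> are smaller than all letters of \<open>u\<close>.\<close>

lemma placements_run:
  assumes "decreasing D" "D = [] \<or> w = [] \<or> last D \<le> hd w"
    and "successively overlap (u # us)" "\<And>v. v \<in> set (u # us) \<Longrightarrow> decreasing v"
    and "u \<noteq> []"
  shows "placements (u # us) (D @ w) = of_bool (sublist u D) * placements us w + placements (u # us) w"
  using assms(1,2)
proof (induction D)
  case Nil
  then show ?case using assms(5) by simp
next
  case (Cons x D)
  have tl: "decreasing D" "D = [] \<or> w = [] \<or> last D \<le> hd w" using Cons.prems by auto
  have iff: "prefix u (x # D @ w) \<longleftrightarrow> prefix u (x # D)"
    using prefix_run[of u "x # D" w] Cons.prems assms(4)
    by (metis append_Cons list.distinct(1) list.set_intros(1) prefix_prefix)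
  show ?case
  proof (cases "prefix u (x # D)")
    case True
    then obtain R where R: "x # D = u @ R" by (auto simp: prefix_def)
    have "decreasing (u @ R)" using Cons.prems R by metis
    then have dR: "decreasing R" and gt: "\<And>a b. a \<in> set u \<Longrightarrow> b \<in> set R \<Longrightarrow> b < a"
      by (auto simp: sorted_wrt_append)
    have lR: "R = [] \<or> w = [] \<or> last R \<le> hd w"
      using Cons.prems(2) R by (metis last_append list.distinct(1))
    \<comment> \<open>A next block inside the rest \<open>R\<close> of the run would lie below
      \<open>u\<close>, against overlapping.\<close>
    have "placements us (R @ w) = placements us w"
    proof (cases us)
      case (Cons v vs)
      have "\<not> sublist v R"
      proof
        assume "sublist v R"
        then have "below v u" using gt set_mono_sublist unfolding below_def by blast
        then show False using assms(3) Cons by (auto simp: overlap_def)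
      qed
      then show ?thesis using placements_skip[OF dR lR] assms(4) Cons by auto
    qed simp
    moreover have "drop (length u) (x # D @ w) = R @ w"
      using R by (metis append.assoc append_Cons append_eq_conv_conj)
    \<comment> \<open>The first letter of a decreasing run does not recur in it, so \<open>u\<close>
      fits into the run only here.\<close>
    moreover have "\<not> sublist u D"
    proof
      assume "sublist u D"
      moreover have "x \<in> set u" using R assms(5) by (cases u) auto
      ultimately have "x \<in> set D" using set_mono_sublist by blast
      then show False using Cons.prems by auto
    qed
    then have "placements (u # us) (D @ w) = placements (u # us) w"
      using placements_skip[OF tl] assms(4) by auto
    ultimately show ?thesis using True iff by (simp add: sublist_Cons_right)
  next
    case False
    then show ?thesis using Cons.IH[OF tl] iff by (simp add: sublist_Cons_right)
  qed
qed

section \<open>Run decompositions as sequences of runs\<close>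

definition run_list :: "nat list list \<Rightarrow> bool" where
  "run_list ds \<longleftrightarrow> (\<forall>D\<in>set ds. D \<noteq> [] \<and> decreasing D) \<and> normal ds"

lemma decreasing_bounds:
  assumes "decreasing D" "a \<in> set D"
  shows "last D \<le> a" "a \<le> hd D"
proof -
  obtain i where i: "i < length D" "D ! i = a" using assms(2) by (metis in_set_conv_nth)
  have "D ! j \<le> D ! k" if "k \<le> j" "j < length D" for j k
    using sorted_wrt_nth_less[OF assms(1), of k j] that by (cases "k = j") auto
  then show "last D \<le> a" "a \<le> hd D"
    using i by (cases "D = []"; force simp: last_conv_nth hd_conv_nth)+
qed

text \<open>Hence normality at a junction says that there is no descent from the last letter of one
  run to the first letter of the next.\<close>

lemma below_decreasing_iff:
  assumes "decreasing D" "decreasing E" "D \<noteq> []" "E \<noteq> []"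
  shows "below E D \<longleftrightarrow> hd E < last D"
proof
  show "below E D \<Longrightarrow> hd E < last D" using assms by (auto simp: below_def)
  show "hd E < last D \<Longrightarrow> below E D"
    unfolding below_def using decreasing_bounds(1)[OF assms(1)] decreasing_bounds(2)[OF assms(2)]
    by (meson le_less_trans less_le_trans)
qed

text \<open>The junction is expressed by letters of \<open>concat ds\<close>, to fit the lemmas on
  words \<open>D @ w\<close>.\<close>

lemma run_list_Cons:
  "run_list (D # ds) \<longleftrightarrow>
    D \<noteq> [] \<and> decreasing D \<and> run_list ds \<and> (concat ds = [] \<or> last D \<le> hd (concat ds))"
proof (cases ds)
  case (Cons E es)
  then show ?thesis
    using below_decreasing_iff[of D E] by (auto simp: run_list_def)
qed (simp add: run_list_def)

lemma placements_concat:
  assumes "run_list ds" "successively overlap us" "\<And>u. u \<in> set us \<Longrightarrow> u \<noteq> [] \<and> decreasing u"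
  shows "placements us (concat ds) = chains us ds"
  using assms
proof (induction ds arbitrary: us)
  case Nil
  then show ?case by (cases us) auto
next
  case (Cons D ds)
  note IH = Cons
  show ?case
  proof (cases us)
    case (Cons u vs)
    have "placements (u # vs) (D @ concat ds) =
        of_bool (sublist u D) * placements vs (concat ds) + placements (u # vs) (concat ds)"
      using IH(2-4) Cons by (intro placements_run) (auto simp: run_list_Cons)
    moreover have "run_list ds" using IH(2) by (simp add: run_list_Cons)
    then have "placements vs (concat ds) = chains vs ds" "placements us (concat ds) = chains us ds"
      using IH(1)[of vs] IH(1)[of us] IH(3,4) Cons by (auto simp: successively_Cons)
    ultimately show ?thesis using Cons by simp
  qed simp
qed

section \<open>Occurrences of dashed patterns\<close>

text \<open>Blockwise form of the adjacency condition in \<open>occurrences\<close>, by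
  \<open>aligned_iff\<close>. Only the block lengths enter, and the order of the intervals is left
  to \<open>embeddings\<close>.\<close>

fun aligned :: "nat list list \<Rightarrow> nat list \<Rightarrow> bool" where
  "aligned [] js \<longleftrightarrow> js = []"
| "aligned (u # us) js \<longleftrightarrow> (\<exists>s ks. js = [s..<s + length u] @ ks \<and> aligned us ks)"

lemma dash_after_Cons:
  assumes "[] \<notin> set (u # us)"
  shows "dash_after (u # us) s \<longleftrightarrow>
    us \<noteq> [] \<and> Suc s = length u \<or> length u \<le> s \<and> dash_after us (s - length u)"
proof
  assume "dash_after (u # us) s"
  then obtain k where k: "k < length (u # us)" "0 < k" "Suc s = length (concat (take k (u # us)))"
    unfolding dash_after_def by auto
  then obtain k' where k': "k = Suc k'" by (cases k) auto
  show "us \<noteq> [] \<and> Suc s = length u \<or> length u \<le> s \<and> dash_after us (s - length u)"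
  proof (cases "k' = 0")
    case True
    then show ?thesis using k k' by auto
  next
    case False
    then have "length (concat (take k' us)) > 0"
      using assms k k' by (cases us; cases k') auto
    then obtain m where "length (concat (take k' us)) = Suc m" by (metis gr0_conv_Suc)
    then have "length u \<le> s" "Suc (s - length u) = length (concat (take k' us))"
      using k k' by (auto simp del: length_concat)
    then show ?thesis using k k' False unfolding dash_after_def by auto
  qed
next
  assume "us \<noteq> [] \<and> Suc s = length u \<or> length u \<le> s \<and> dash_after us (s - length u)"
  then show "dash_after (u # us) s"
  proof (elim disjE conjE)
    assume "us \<noteq> []" "Suc s = length u"
    then show ?thesis unfolding dash_after_def by (intro exI[of _ 1]) auto
  next
    assume a: "length u \<le> s" "dash_after us (s - length u)"
    then obtain k where "k < length us" "Suc (s - length u) = length (concat (take k us))"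
      unfolding dash_after_def by auto
    then show ?thesis using a(1) unfolding dash_after_def by (intro exI[of _ "Suc k"]) auto
  qed
qed

lemma aligned_iff:
  assumes "[] \<notin> set us"
  shows "aligned us js \<longleftrightarrow> length js = length (concat us) \<and>
    (\<forall>s. Suc s < length js \<and> \<not> dash_after us s \<longrightarrow> js ! Suc s = Suc (js ! s))"
  using assms
proof (induction us arbitrary: js)
  case (Cons u us)
  let ?n = "length u"
  note dash = dash_after_Cons[OF Cons.prems]
  have n: "0 < ?n" and IH: "\<And>js. aligned us js \<longleftrightarrow> length js = length (concat us) \<and>
    (\<forall>s. Suc s < length js \<and> \<not> dash_after us s \<longrightarrow> js ! Suc s = Suc (js ! s))"
    using Cons by auto
  show ?case (is "_ \<longleftrightarrow> ?R")
  proof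
    assume "aligned (u # us) js"
    then obtain s ks where js: "js = [s..<s + ?n] @ ks" and ks: "aligned us ks" by auto
    have "js ! Suc t = Suc (js ! t)" if t: "Suc t < length js" "\<not> dash_after (u # us) t" for t
    proof -
      consider "Suc t < ?n" | "Suc t = ?n" | "?n \<le> t" by linarith
      then show ?thesis
      proof cases
        case 1
        then show ?thesis using js by (simp add: nth_append)
      next
        \<comment> \<open>A dash follows the first block as soon as there is another block, so
          nothing is demanded here.\<close>
        case 2
        then have "us \<noteq> []" using t(1) js ks by auto
        then show ?thesis using 2 t(2) dash by auto
      next
        case 3
        then have "\<not> dash_after us (t - ?n)" using t(2) dash by auto
        then show ?thesis using 3 t(1) ks IH[of ks] js by (simp add: nth_append Suc_diff_le)
      qed
    qed
    then show ?R using js ks IH[of ks] by auto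
  next
    assume R: ?R
    \<comment> \<open>No dash interrupts the first block, so its positions form an interval starting
      at \<open>js ! 0\<close>.\<close>
    have i: "js ! i = js ! 0 + i" if "i < ?n" for i
      using that
    proof (induction i)
      case (Suc i)
      then have "\<not> dash_after (u # us) i" using dash by auto
      then have "js ! Suc i = Suc (js ! i)" using R Suc.prems by auto
      then show ?case using Suc by simp
    qed simp
    have "take ?n js = [js ! 0..<js ! 0 + ?n]"
      using R i by (intro nth_equalityI) auto
    then have js: "js = [js ! 0..<js ! 0 + ?n] @ drop ?n js"
      by (metis append_take_drop_id)
    have "drop ?n js ! Suc s = Suc (drop ?n js ! s)"
      if s: "Suc s < length (drop ?n js)" "\<not> dash_after us s" for s
    proof -
      have "\<not> dash_after (u # us) (s + ?n)" using dash s by auto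
      then have "js ! Suc (s + ?n) = Suc (js ! (s + ?n))" using R s(1) by auto
      then show ?thesis using s(1) by (simp add: add.commute)
    qed
    then have "aligned us (drop ?n js)" using R IH by auto
    then show "aligned (u # us) js" using js by auto
  qed
qed auto

text \<open>Here \<open>us\<close> consists of letters of the word, not of the pattern: these are
  occurrences with prescribed letters, which \<open>placements\<close> counts.\<close>

definition embeddings :: "nat list list \<Rightarrow> nat list \<Rightarrow> nat list set" where
  "embeddings us w = {js. aligned us js \<and> sorted_wrt (<) js \<and> set js \<subseteq> {..<length w} \<and>
     map (nth w) js = concat us}"

section \<open>Splitting embeddings by the use of the first letter\<close>

lemma aligned_shift: "aligned us (map ((+) k) js) \<longleftrightarrow> aligned us js"
proof (induction us arbitrary: js)
  case (Cons u us)
  show ?case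
  proof
    assume "aligned (u # us) (map ((+) k) js)"
    then obtain s ks where a: "map ((+) k) js = [s..<s + length u] @ ks" "aligned us ks" by auto
    then obtain xs ys where js: "js = xs @ ys" "map ((+) k) xs = [s..<s + length u]" "map ((+) k) ys = ks"
      by (auto simp: map_eq_append_conv)
    have len: "length xs = length u" using js(2) by (metis length_map length_upt add_diff_cancel_left')
    have nth: "k + xs ! i = s + i" if "i < length u" for i
      using arg_cong[OF js(2), of "\<lambda>zs. zs ! i"] that len by simp
    \<comment> \<open>Truncation in \<open>s - k\<close> is harmless: a nonempty \<open>xs\<close>
      gives \<open>k \<le> s\<close>, and otherwise both sides are empty.\<close>
    have "xs = [s - k..<s - k + length u]"
      using len nth by (intro nth_equalityI) (auto, metis Nat.add_diff_assoc2 add.right_neutral add_diff_cancel_left' gr_implies_not0 le_add1 neq0_conv)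
    then show "aligned (u # us) js" using js a Cons by auto
  next
    assume "aligned (u # us) js"
    then obtain s ks where a: "js = [s..<s + length u] @ ks" "aligned us ks" by auto
    have "map ((+) k) [s..<s + length u] = [k + s..<k + s + length u]"
      by (intro nth_equalityI) auto
    then show "aligned (u # us) (map ((+) k) js)" using a Cons by auto
  qed
qed simp

text \<open>This and \<open>embeddings_zero\<close> give the two summands in the recursion of
  \<open>placements\<close>.\<close>

lemma embeddings_nonzero:
  "{js \<in> embeddings us (x # w). 0 \<notin> set js} = map ((+) 1) ` embeddings us w"
proof (intro equalityI subsetI)
  fix js assume "js \<in> {js \<in> embeddings us (x # w). 0 \<notin> set js}"
  then have js: "js \<in> embeddings us (x # w)" "0 \<notin> set js" by auto
  define ks where "ks = map (\<lambda>j. j - 1) js"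
  have "j = 1 + (j - 1)" if "j \<in> set js" for j
    using that js(2) by (metis Suc_pred' plus_1_eq_Suc neq0_conv)
  then have eq: "js = map ((+) 1) ks"
    unfolding ks_def by (auto simp: map_idI)
  have "ks \<in> embeddings us w"
    using js(1) aligned_shift[of us 1 ks] unfolding eq embeddings_def
    by (auto simp: sorted_wrt_map comp_def image_subset_iff)
  then show "js \<in> map ((+) 1) ` embeddings us w" using eq by blast
next
  fix js assume "js \<in> map ((+) 1) ` embeddings us w"
  then obtain ks where "ks \<in> embeddings us w" "js = map ((+) 1) ks" by auto
  then show "js \<in> {js \<in> embeddings us (x # w). 0 \<notin> set js}"
    using aligned_shift[of us 1 ks] unfolding embeddings_def
    by (auto simp: sorted_wrt_map comp_def)
qed

lemma embeddings_zero:
  assumes "u \<noteq> []"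
  shows "{js \<in> embeddings (u # us) w. 0 \<in> set js} =
    (if prefix u w
     then (\<lambda>ks. [0..<length u] @ map ((+) (length u)) ks) ` embeddings us (drop (length u) w)
     else {})"
proof -
  let ?n = "length u"
  have fwd: "prefix u w \<and> (\<exists>ks \<in> embeddings us (drop ?n w). js = [0..<?n] @ map ((+) ?n) ks)"
    if js: "js \<in> embeddings (u # us) w" "0 \<in> set js" for js
  proof -
    obtain s ls where a: "js = [s..<s + ?n] @ ls" "aligned us ls"
      using js unfolding embeddings_def by auto
    have sorted: "sorted_wrt (<) js" and sub: "set js \<subseteq> {..<length w}"
      and mp: "map (nth w) js = u @ concat us"
      using js unfolding embeddings_def by auto
    \<comment> \<open>The positions increase, so \<open>s\<close> is the least one; as 0 is a
      position, \<open>s\<close> is 0.\<close>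
    have "s \<in> set [s..<s + ?n]" using assms by (cases u) auto
    then have "\<forall>l\<in>set ls. s < l" using sorted a(1) by (auto simp: sorted_wrt_append)
    then have s0: "s = 0" using js(2) a(1) by auto
    \<comment> \<open>The remaining positions lie beyond the first block, so shifting them back by
      its length loses nothing.\<close>
    have ge: "?n \<le> l" if "l \<in> set ls" for l
    proof -
      have "?n - 1 \<in> set [s..<s + ?n]" using s0 assms by (cases u) auto
      then have "?n - 1 < l" using that sorted a(1) by (auto simp: sorted_wrt_append)
      then show ?thesis by simp
    qed
    define ks where "ks = map (\<lambda>l. l - ?n) ls"
    have eq: "ls = map ((+) ?n) ks"
      using ge unfolding ks_def by (auto simp: map_idI)
    have m: "map (nth w) [0..<?n] = u" "map (nth w) ls = concat us"
      using mp a(1) s0 by (auto simp: append_eq_append_conv)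
    have nw: "?n \<le> length w"
      using sub a(1) s0 assms by (cases u) auto
    have "take ?n w = u"
      using m(1) nw by (metis map_nth take_map take_upt add.left_neutral)
    then have pre: "prefix u w" by (metis take_is_prefix)
    have "map (nth (drop ?n w)) ks = map (\<lambda>i. w ! (?n + i)) ks"
      using nw by (intro map_cong) auto
    also have "\<dots> = concat us" using m(2) eq by (simp add: comp_def)
    finally have "ks \<in> embeddings us (drop ?n w)"
      using a(2) sorted sub m(2) nw aligned_shift[of us ?n ks] unfolding a(1) s0 embeddings_def eq
      by (auto simp: sorted_wrt_map sorted_wrt_append comp_def image_subset_iff)
    then show ?thesis using pre a(1) s0 eq by auto
  qed
  have bwd: "[0..<?n] @ map ((+) ?n) ks \<in> embeddings (u # us) w"
    "0 \<in> set ([0..<?n] @ map ((+) ?n) ks)"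
    if pre: "prefix u w" and ks: "ks \<in> embeddings us (drop ?n w)" for ks
  proof -
    obtain v where w: "w = u @ v" using pre by (auto simp: prefix_def)
    have "map (nth w) [0..<?n] = u" using w by (simp add: map_upt_eqI nth_append)
    moreover have "map (nth w) (map ((+) ?n) ks) = concat us"
      using ks w by (auto simp: embeddings_def comp_def)
    ultimately have m: "map (nth w) ([0..<?n] @ map ((+) ?n) ks) = concat (u # us)"
      by (simp only: map_append concat.simps)
    have a: "aligned (u # us) ([0..<?n] @ map ((+) ?n) ks)"
      using ks aligned_shift[of us ?n ks] by (auto simp: embeddings_def intro!: exI[of _ 0])
    have "sorted_wrt (<) ([0..<?n] @ map ((+) ?n) ks)"
      "set ([0..<?n] @ map ((+) ?n) ks) \<subseteq> {..<length w}"
      using ks w by (auto simp: embeddings_def sorted_wrt_append sorted_wrt_map)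
    with a m show "[0..<?n] @ map ((+) ?n) ks \<in> embeddings (u # us) w"
      unfolding embeddings_def by blast
    show "0 \<in> set ([0..<?n] @ map ((+) ?n) ks)" using assms by auto
  qed
  show ?thesis
  proof (cases "prefix u w")
    case True
    have "{js \<in> embeddings (u # us) w. 0 \<in> set js} =
        (\<lambda>ks. [0..<?n] @ map ((+) ?n) ks) ` embeddings us (drop ?n w)"
      (is "?L = ?R")
    proof (intro equalityI subsetI)
      show "js \<in> ?R" if "js \<in> ?L" for js
        using fwd[of js] that by blast
      show "js \<in> ?L" if "js \<in> ?R" for js
        using bwd[OF True] that by blast
    qed
    then show ?thesis using True by simp
  next
    case False
    then have "{js \<in> embeddings (u # us) w. 0 \<in> set js} = {}" using fwd by blast
    then show ?thesis using False by (simp only: if_False)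
  qed
qed

lemma finite_embeddings: "finite (embeddings us w)"
proof (rule finite_subset)
  show "embeddings us w \<subseteq> {js. set js \<subseteq> {..<length w} \<and> length js = length (concat us)}"
    unfolding embeddings_def by (auto dest: arg_cong[of _ _ length])
qed (simp add: finite_lists_length_eq)

lemma card_embeddings:
  assumes "[] \<notin> set us"
  shows "card (embeddings us w) = placements us w"
  using assms
proof (induction us w rule: placements.induct)
  case (1 w)
  have "embeddings [] w = {[]}" by (auto simp: embeddings_def)
  then show ?case by simp
next
  case (2 u us)
  then have "embeddings (u # us) [] = {}" by (auto simp: embeddings_def)
  then show ?case by simp
next
  case (3 u us x w)
  let ?E = "embeddings (u # us) (x # w)"
  have "card ?E = card {js \<in> ?E. 0 \<in> set js} + card {js \<in> ?E. 0 \<notin> set js}"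
    by (subst card_Un_disjoint[symmetric]) (auto simp: finite_embeddings intro: arg_cong[of _ _ card])
  also have "card {js \<in> ?E. 0 \<notin> set js} = placements (u # us) w"
    unfolding embeddings_nonzero using 3
    by (subst card_image) (auto intro: inj_onI dest: map_injective)
  also have "card {js \<in> ?E. 0 \<in> set js} =
      (if prefix u (x # w) then placements us (drop (length u) (x # w)) else 0)"
  proof (cases "prefix u (x # w)")
    case True
    have "inj_on (\<lambda>ks. [0..<length u] @ map ((+) (length u)) ks) A" for A
      by (auto intro!: inj_onI dest: map_injective)
    moreover have "u \<noteq> []" using 3 by auto
    ultimately show ?thesis
      using True 3 embeddings_zero[of u us "x # w"] by (simp add: card_image)
  next
    case False
    moreover have "u \<noteq> []" using 3 by auto
    ultimately have "{js \<in> ?E. 0 \<in> set js} = {}" using embeddings_zero[of u us "x # w"] by simp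
    then show ?thesis using False by (simp only: if_False card.empty)
  qed
  finally show ?case by simp
qed

section \<open>From patterns to blocks of letters\<close>

definition instances :: "dpattern \<Rightarrow> nat set \<Rightarrow> nat list list set" where
  "instances p A = {map (map f) p | f.
     strict_mono_on (set (concat p)) f \<and> f ` set (concat p) \<subseteq> A}"

lemma order_isomorphic_iff:
  fixes xs ys :: "nat list"
  assumes "length xs = length ys"
  shows "(\<forall>s<length xs. \<forall>t<length xs. xs ! s > xs ! t \<longleftrightarrow> ys ! s > ys ! t) \<longleftrightarrow>
    (\<exists>f. strict_mono_on (set ys) f \<and> xs = map f ys)"
proof
  assume iso: "\<forall>s<length xs. \<forall>t<length xs. xs ! s > xs ! t \<longleftrightarrow> ys ! s > ys ! t"
  \<comment> \<open>Any position of \<open>a\<close> in \<open>ys\<close> may be chosen: equal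
    letters of \<open>ys\<close> force equal letters of \<open>xs\<close>.\<close>
  define f where "f a = xs ! (SOME s. s < length ys \<and> ys ! s = a)" for a
  have f: "f (ys ! s) = xs ! s" if s: "s < length ys" for s
  proof -
    let ?t = "SOME t. t < length ys \<and> ys ! t = ys ! s"
    have "?t < length ys \<and> ys ! ?t = ys ! s"
      by (rule someI[of _ s]) (simp add: s)
    then have "\<not> xs ! ?t < xs ! s" "\<not> xs ! s < xs ! ?t" using iso s assms by auto
    then show ?thesis by (simp add: f_def)
  qed
  have "strict_mono_on (set ys) f"
  proof (rule strict_mono_onI)
    fix a b assume ab: "a \<in> set ys" "b \<in> set ys" "a < b"
    obtain s t where "s < length ys" "ys ! s = a" "t < length ys" "ys ! t = b"
      using ab by (auto simp: in_set_conv_nth)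
    then show "f a < f b" using f[of s] f[of t] iso ab(3) assms by auto
  qed
  moreover have "xs = map f ys"
    using f assms by (intro nth_equalityI) auto
  ultimately show "\<exists>f. strict_mono_on (set ys) f \<and> xs = map f ys" by blast
next
  assume "\<exists>f. strict_mono_on (set ys) f \<and> xs = map f ys"
  then obtain f where f: "strict_mono_on (set ys) f" "xs = map f ys" by blast
  then show "\<forall>s<length xs. \<forall>t<length xs. xs ! s > xs ! t \<longleftrightarrow> ys ! s > ys ! t"
    by (auto simp: strict_mono_on_less)
qed

lemma dash_after_map_map: "dash_after (map (map f) p) = dash_after p"
  by (simp add: dash_after_def take_map length_concat comp_def fun_eq_iff)

lemma embeddings_iff:
  assumes "[] \<notin> set us"
  shows "js \<in> embeddings us w \<longleftrightarrow>
    sorted_wrt (<) js \<and> set js \<subseteq> {..<length w} \<and> map (nth w) js = concat us \<and>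
    (\<forall>s. Suc s < length js \<and> \<not> dash_after us s \<longrightarrow> js ! Suc s = Suc (js ! s))"
  unfolding embeddings_def aligned_iff[OF assms] by (auto dest: arg_cong[of _ _ length])

text \<open>Occurrences are classified by the letters they pick out; being order isomorphic to the
  pattern means that these arise from it by a strictly increasing map.\<close>

lemma occurrences_eq_UN:
  assumes "[] \<notin> set p"
  shows "occurrences p w = (\<Union>us\<in>instances p (set w). embeddings us w)"
proof (intro equalityI subsetI)
  fix js assume js: "js \<in> occurrences p w"
  let ?xs = "map (nth w) js"
  have len: "length ?xs = length (concat p)" using js by (simp add: occurrences_def)
  have "\<forall>s<length ?xs. \<forall>t<length ?xs. ?xs ! s > ?xs ! t \<longleftrightarrow> concat p ! s > concat p ! t"
    using js by (simp add: occurrences_def)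
  then obtain f where f: "strict_mono_on (set (concat p)) f" "?xs = map f (concat p)"
    unfolding order_isomorphic_iff[OF len] by blast
  let ?us = "map (map f) p"
  have "f ` set (concat p) = set ?xs" using f(2) by simp
  also have "\<dots> \<subseteq> set w" using js by (auto simp: occurrences_def)
  finally have "?us \<in> instances p (set w)" using f(1) by (auto simp: instances_def)
  moreover have "js \<in> embeddings ?us w"
    using js f(2) assms by (subst embeddings_iff) (auto simp: occurrences_def dash_after_map_map map_concat)
  ultimately show "js \<in> (\<Union>us\<in>instances p (set w). embeddings us w)" by blast
next
  fix js assume "js \<in> (\<Union>us\<in>instances p (set w). embeddings us w)"
  then obtain f where f: "strict_mono_on (set (concat p)) f" "js \<in> embeddings (map (map f) p) w"
    by (auto simp: instances_def)
  let ?xs = "map (nth w) js"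
  have e: "sorted_wrt (<) js" "set js \<subseteq> {..<length w}" "?xs = map f (concat p)"
    "\<forall>s. Suc s < length js \<and> \<not> dash_after p s \<longrightarrow> js ! Suc s = Suc (js ! s)"
    using f(2) assms by (subst (asm) embeddings_iff; auto simp: dash_after_map_map map_concat)+
  have len: "length ?xs = length (concat p)" using e(3) by (metis length_map)
  have "\<forall>s<length ?xs. \<forall>t<length ?xs. ?xs ! s > ?xs ! t \<longleftrightarrow> concat p ! s > concat p ! t"
    unfolding order_isomorphic_iff[OF len] using f(1) e(3) by blast
  then show "js \<in> occurrences p w" using e(1,2,4) len by (simp add: occurrences_def)
qed

lemma finite_instances: "finite A \<Longrightarrow> finite (instances p A)"
proof -
  assume A: "finite A"
  let ?U = "{u. set u \<subseteq> A \<and> length u \<le> length (concat p)}"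
  have "length u \<le> length (concat p)" if "u \<in> set p" for u
    using that by (induction p) auto
  then have "instances p A \<subseteq> {us. set us \<subseteq> ?U \<and> length us = length p}"
    by (auto simp: instances_def image_subset_iff)
  then show ?thesis
    by (rule finite_subset) (rule finite_lists_length_eq[OF finite_lists_length_le[OF A]])
qed

lemma occ_eq_sum:
  assumes "[] \<notin> set p"
  shows "occ p w = (\<Sum>us\<in>instances p (set w). placements us w)"
proof -
  \<comment> \<open>An embedding determines the concatenation of its blocks, hence the letter map on
    the letters of \<open>p\<close>, hence the blocks.\<close>
  have disj: "embeddings us w \<inter> embeddings vs w = {}"
    if uv: "us \<in> instances p (set w)" "vs \<in> instances p (set w)" "us \<noteq> vs" for us vs
  proof (rule ccontr)
    assume "embeddings us w \<inter> embeddings vs w \<noteq> {}"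
    then have eq: "concat us = concat vs" unfolding embeddings_def by auto
    obtain f g where fg: "us = map (map f) p" "vs = map (map g) p"
      using uv by (auto simp: instances_def)
    with eq have "map f (concat p) = map g (concat p)" by (simp only: map_concat)
    then have "\<forall>a\<in>set (concat p). f a = g a" by (simp only: map_eq_conv)
    then have "us = vs" using fg by simp
    then show False using uv by simp
  qed
  have "occ p w = (\<Sum>us\<in>instances p (set w). card (embeddings us w))"
    unfolding occ_def occurrences_eq_UN[OF assms]
    by (rule card_UN_disjoint) (auto simp: finite_instances finite_embeddings disj)
  also have "\<dots> = (\<Sum>us\<in>instances p (set w). placements us w)"
    by (rule sum.cong) (use assms in \<open>auto simp: instances_def intro!: card_embeddings\<close>)
  finally show ?thesis .
qed

lemma instances_rev: "instances (rev p) A = rev ` instances p A"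
  unfolding instances_def setcompr_eq_image by (simp add: image_image rev_map)

lemma instances_blocks:
  assumes "us \<in> instances p A" "[] \<notin> set p" "piecewise_decreasing p"
  shows "\<And>u. u \<in> set us \<Longrightarrow> u \<noteq> [] \<and> decreasing u"
proof -
  obtain f where f: "us = map (map f) p" "strict_mono_on (set (concat p)) f"
    using assms(1) by (auto simp: instances_def)
  fix u assume "u \<in> set us"
  then obtain v where v: "v \<in> set p" "u = map f v" using f(1) by auto
  have "decreasing v" using assms(3) v(1) by (auto simp: piecewise_decreasing_def)
  then have "sorted_wrt (\<lambda>a b. f a > f b) v"
    by (rule sorted_wrt_mono_rel[rotated]) (use strict_mono_onD[OF f(2)] v(1) in auto)
  then have "decreasing u" unfolding v(2) sorted_wrt_map .
  then show "u \<noteq> [] \<and> decreasing u" using v assms(2) by auto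
qed

lemma overlap_if_incomparable_or_eq:
  assumes "\<not> comparable u v \<or> u = v" "u \<noteq> []"
  shows "overlap u v"
  using assms overlap_self by (auto simp: comparable_def below_eq_def overlap_def)

text \<open>A strictly increasing letter map preserves and reflects \<open>below\<close>, so
  connectedness passes from the pattern to its instances.\<close>

lemma instances_overlap:
  assumes "us \<in> instances p A" "[] \<notin> set p" "connected_pattern p"
  shows "successively overlap us"
proof -
  obtain f where f: "us = map (map f) p" "strict_mono_on (set (concat p)) f"
    using assms(1) by (auto simp: instances_def)
  have iff: "below (map f u) (map f v) \<longleftrightarrow> below u v" if "u \<in> set p" "v \<in> set p" for u v
    using strict_mono_on_less[OF f(2)] that by (fastforce simp: below_def)
  show ?thesis
    unfolding successively_conv_nth
  proof (intro allI impI)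
    fix i assume i: "Suc i < length us"
    then have mem: "p ! i \<in> set p" "p ! Suc i \<in> set p" using f(1) by auto
    have "\<not> comparable (p ! i) (p ! Suc i) \<or> p ! i = p ! Suc i"
      using assms(3) i f(1) by (simp add: connected_pattern_def)
    then have "overlap (p ! i) (p ! Suc i)"
      using mem assms(2) by (intro overlap_if_incomparable_or_eq) auto
    then show "overlap (us ! i) (us ! Suc i)"
      using i f(1) iff[OF mem] iff[OF mem(2,1)] by (simp add: overlap_def)
  qed
qed

section \<open>Descending runs\<close>

text \<open>Recursive run decomposition; \<open>descending_runs_eq\<close> identifies its multiset
  with the one defined by maximal intervals.\<close>

fun runs :: "nat list \<Rightarrow> nat list list" where
  "runs [] = []"
| "runs (x # w) = (case runs w of [] \<Rightarrow> [[x]]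
     | D # ds \<Rightarrow> if hd D < x then (x # D) # ds else [x] # D # ds)"

lemma concat_runs: "concat (runs w) = w"
  by (induction w) (auto split: list.splits)

lemma run_list_runs: "run_list (runs w)"
proof (induction w)
  case Nil
  then show ?case by (simp add: run_list_def)
next
  case (Cons x w)
  have "a < x" if "decreasing D" "hd D < x" "a \<in> set D" for a D
    using decreasing_bounds(2)[OF that(1,3)] that(2) by linarith
  then show ?case
    using Cons by (auto simp: run_list_Cons run_list_def[of "[]"] split: list.split)
qed

lemma runs_append:
  assumes "decreasing D" "D \<noteq> []" "w = [] \<or> last D \<le> hd w"
  shows "runs (D @ w) = D # runs w"
  using assms
proof (induction D)
  case (Cons x D)
  show ?case
  proof (cases D)
    case Nil
    have "hd E = hd w \<and> w \<noteq> []" if "runs w = E # es" for E es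
      using that concat_runs[of w] run_list_runs[of w] by (auto simp: run_list_Cons)
    then show ?thesis using Nil Cons.prems(3) by (fastforce split: list.split)
  next
    case (Cons y D')
    then have "runs (D @ w) = D # runs w" using Cons.IH Cons.prems by auto
    then show ?thesis using Cons Cons.prems by auto
  qed
qed simp

text \<open>With \<open>concat_runs\<close> and \<open>run_list_runs\<close>, this makes
  \<open>runs\<close> a bijection from words onto the sequences satisfying
  \<open>run_list\<close>.\<close>

lemma runs_concat: "run_list ds \<Longrightarrow> runs (concat ds) = ds"
proof (induction ds)
  case (Cons D ds)
  then show ?case using runs_append[of D "concat ds"] by (auto simp: run_list_Cons)
qed simp

section \<open>Runs as maximal decreasing intervals\<close>

lemma length_factor: "length (factor w i j) = min (length w - i) (j - i)"
  by (simp add: factor_def min.commute)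

lemma nth_factor: "k < j - i \<Longrightarrow> i + k < length w \<Longrightarrow> factor w i j ! k = w ! (i + k)"
  by (simp add: factor_def)

text \<open>Such a factor contains the last letter of \<open>D\<close> and the first of
  \<open>w\<close>, which do not form a descent.\<close>

lemma not_decreasing_factor_append:
  assumes "D \<noteq> []" "w = [] \<or> last D \<le> hd w" "i < length D" "length D < j" "j \<le> length (D @ w)"
  shows "\<not> decreasing (factor (D @ w) i j)"
proof
  let ?k = "length D - 1 - i"
  assume "decreasing (factor (D @ w) i j)"
  then have "factor (D @ w) i j ! ?k > factor (D @ w) i j ! Suc ?k"
    by (rule sorted_wrt_nth_less) (use assms in \<open>auto simp: length_factor\<close>)
  moreover have "factor (D @ w) i j ! ?k = (D @ w) ! (length D - 1)"
    using assms by (subst nth_factor) auto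
  moreover have "factor (D @ w) i j ! Suc ?k = (D @ w) ! length D"
    using assms by (subst nth_factor) auto
  moreover have "w \<noteq> []" using assms(4,5) by auto
  ultimately have "last D > hd w" using assms by (auto simp: nth_append last_conv_nth hd_conv_nth)
  then show False using assms(2) \<open>w \<noteq> []\<close> by auto
qed

lemma factor_append_shift: "factor (D @ w) (length D + i) (length D + j) = factor w i j"
  by (simp add: factor_def)

text \<open>No decreasing interval crosses the border. One that starts in \<open>D\<close> is
  therefore maximal only if it is all of \<open>D\<close>, and maximality of the others can be
  tested in \<open>w\<close>.\<close>

lemma run_intervals_append:
  assumes "decreasing D" "D \<noteq> []" "w = [] \<or> last D \<le> hd w"
  shows "run_intervals (D @ w) =
    insert (0, length D) ((\<lambda>(i, j). (length D + i, length D + j)) ` run_intervals w)"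
proof (intro equalityI subsetI)
  let ?n = "length D"
  note nd = not_decreasing_factor_append[OF assms(2,3)]
  have D: "factor (D @ w) 0 ?n = D" by (simp add: factor_def)
  {
    fix ij assume ij: "ij \<in> run_intervals (D @ w)"
    obtain i j where [simp]: "ij = (i, j)" by force
    have m: "i < j" "j \<le> length (D @ w)" "decreasing (factor (D @ w) i j)"
      "\<And>i' j'. i' \<le> i \<Longrightarrow> j \<le> j' \<Longrightarrow> j' \<le> length (D @ w) \<Longrightarrow>
        decreasing (factor (D @ w) i' j') \<Longrightarrow> i' = i \<and> j' = j"
      using ij by (auto simp: run_intervals_def)
    show "ij \<in> insert (0, ?n) ((\<lambda>(i, j). (?n + i, ?n + j)) ` run_intervals w)"
    proof (cases "i < ?n")
      case True
      then have "j \<le> ?n" using nd[of i j] m by linarith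
      then have "0 = i \<and> ?n = j" using m(4)[of 0 ?n] D assms(1) by auto
      then show ?thesis by auto
    next
      case False
      define a b where "a = i - ?n" and "b = j - ?n"
      then have eq: "i = ?n + a" "j = ?n + b" using False m(1) by auto
      have "(a, b) \<in> run_intervals w"
        unfolding run_intervals_def
      proof (clarify, intro conjI allI impI)
        show "a < b" "b \<le> length w" "decreasing (factor w a b)"
          using m(1-3) unfolding eq by (auto simp: factor_append_shift)
      next
        fix a' b' assume *: "a' \<le> a \<and> b \<le> b' \<and> b' \<le> length w \<and> decreasing (factor w a' b')"
        then show "a' = a" "b' = b"
          using m(4)[of "?n + a'" "?n + b'"] unfolding eq by (auto simp: factor_append_shift)
      qed
      then show ?thesis using eq by force
    qed
  next
    fix ij assume "ij \<in> insert (0, ?n) ((\<lambda>(i, j). (?n + i, ?n + j)) ` run_intervals w)"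
    then consider "ij = (0, ?n)" | a b where "ij = (?n + a, ?n + b)" "(a, b) \<in> run_intervals w"
      by auto
    then show "ij \<in> run_intervals (D @ w)"
    proof cases
      case 1
      have "j' = ?n" if "?n \<le> j'" "j' \<le> length (D @ w)" "decreasing (factor (D @ w) 0 j')" for j'
        using that nd[of 0 j'] assms(2) by (cases "?n < j'") auto
      then show ?thesis using D assms(1,2) 1 unfolding run_intervals_def by auto
    next
      case (2 a b)
      have m: "a < b" "b \<le> length w" "decreasing (factor w a b)"
        "\<And>i' j'. i' \<le> a \<Longrightarrow> b \<le> j' \<Longrightarrow> j' \<le> length w \<Longrightarrow>
          decreasing (factor w i' j') \<Longrightarrow> i' = a \<and> j' = b"
        using 2(2) by (auto simp: run_intervals_def)
      have "i' = ?n + a \<and> j' = ?n + b"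
        if h: "i' \<le> ?n + a" "?n + b \<le> j'" "j' \<le> length (D @ w)" "decreasing (factor (D @ w) i' j')"
        for i' j'
      proof -
        have "?n \<le> i'" using nd[of i' j'] h m(1) by linarith
        then obtain a' b' where eq: "i' = ?n + a'" "j' = ?n + b'"
          using h(2) by (metis le_Suc_ex le_trans le_add1)
        then show ?thesis using m(4)[of a' b'] h by (auto simp: factor_append_shift)
      qed
      then show ?thesis using 2(1) m(1-3) unfolding run_intervals_def
        by (auto simp: factor_append_shift)
    qed
  }
qed

lemma finite_run_intervals: "finite (run_intervals w)"
  by (rule finite_subset[of _ "{..length w} \<times> {..length w}"]) (auto simp: run_intervals_def)

lemma descending_runs_append:
  assumes "decreasing D" "D \<noteq> []" "w = [] \<or> last D \<le> hd w"
  shows "descending_runs (D @ w) = add_mset D (descending_runs w)"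
proof -
  let ?s = "\<lambda>(i, j). (length D + i, length D + j)"
  have inj: "inj_on ?s (run_intervals w)" by (auto intro!: inj_onI)
  have "(0, length D) \<notin> ?s ` run_intervals w" using assms(2) by auto
  then have "descending_runs (D @ w) = add_mset (factor (D @ w) 0 (length D))
      (image_mset (\<lambda>(i, j). factor (D @ w) i j) (image_mset ?s (mset_set (run_intervals w))))"
    unfolding descending_runs_def run_intervals_append[OF assms] image_mset_mset_set[OF inj]
    by (subst mset_set.insert) (auto simp: finite_run_intervals)
  also have "\<dots> = add_mset D (descending_runs w)"
    unfolding descending_runs_def image_mset.compositionality
    by (simp add: comp_def case_prod_unfold factor_append_shift) (simp add: factor_def)
  finally show ?thesis .
qed

lemma descending_runs_concat: "run_list ds \<Longrightarrow> descending_runs (concat ds) = mset ds"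
proof (induction ds)
  case Nil
  have "run_intervals [] = {}" by (auto simp: run_intervals_def)
  then show ?case by (simp add: descending_runs_def)
next
  case (Cons D ds)
  then show ?case using descending_runs_append[of D "concat ds"] by (auto simp: run_list_Cons)
qed

section \<open>The involution\<close>

definition mirror :: "nat list \<Rightarrow> nat list" where
  "mirror w = concat (normalize (rev (runs w)))"

lemma runs_not_Nil: "[] \<notin> set (runs w)"
  using run_list_runs[of w] by (auto simp: run_list_def)

text \<open>The normal form is itself a run decomposition, so no runs merge in the
  concatenation.\<close>

lemma runs_mirror: "runs (mirror w) = normalize (rev (runs w))"
proof -
  have "run_list (normalize (rev (runs w)))"
    using run_list_runs[of w] runs_not_Nil[of w] normal_normalize[of "rev (runs w)"]
    by (auto simp: run_list_def set_normalize)
  then show ?thesis by (simp add: mirror_def runs_concat)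
qed

lemma mirror_mirror: "mirror (mirror w) = w"
  using run_list_runs[of w] runs_not_Nil[of w]
  by (simp add: mirror_def[of "mirror w"] runs_mirror normalize_rev_normalize_rev run_list_def concat_runs)

lemma descending_runs_eq: "descending_runs w = mset (runs w)"
  using descending_runs_concat[OF run_list_runs, of w] by (simp add: concat_runs)

lemma descending_runs_mirror: "descending_runs (mirror w) = descending_runs w"
  by (simp add: descending_runs_eq runs_mirror mset_normalize)

text \<open>The runs determine the letters. This yields the alphabet, on which
  \<open>instances\<close> depends, and the length.\<close>

lemma mset_mirror: "mset (mirror w) = mset w"
proof -
  have "mset v = \<Sum>\<^sub># (image_mset mset (mset (runs v)))" for v
    by (metis concat_runs mset_concat mset_map sum_mset_sum_list)
  then show ?thesis
    using descending_runs_mirror[of w] unfolding descending_runs_eq by metis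
qed

lemma set_mirror: "set (mirror w) = set w"
  by (metis mset_mirror set_mset_mset)

lemma length_mirror: "length (mirror w) = length w"
  by (metis mset_mirror size_mset)

lemma connected_pattern_rev:
  assumes "connected_pattern p"
  shows "connected_pattern (rev p)"
proof -
  have iff: "connected_pattern q \<longleftrightarrow> successively (\<lambda>u v. \<not> comparable u v \<or> u = v) q" for q
    by (auto simp: connected_pattern_def successively_conv_nth)
  show ?thesis using assms unfolding iff successively_rev
    by (rule successively_mono) (auto simp: comparable_def)
qed

text \<open>A word now enters only through its alphabet and its sequence of runs.\<close>

lemma occ_eq_sum_chains:
  assumes "[] \<notin> set p" "piecewise_decreasing p" "connected_pattern p"
  shows "occ p w = (\<Sum>us\<in>instances p (set w). chains us (runs w))"
  unfolding occ_eq_sum[OF assms(1)]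
proof (rule sum.cong[OF refl])
  fix us assume us: "us \<in> instances p (set w)"
  show "placements us w = chains us (runs w)"
    using placements_concat[OF run_list_runs[of w] instances_overlap[OF us assms(1,3)]
        instances_blocks[OF us assms(1,2)]]
    by (simp add: concat_runs)
qed

text \<open>The alphabet and so the instances are unchanged, normalization does not affect
  \<open>chains\<close>, and the reversal of the runs is passed on to the blocks.\<close>

lemma occ_mirror:
  assumes "[] \<notin> set p" "piecewise_decreasing p" "connected_pattern p"
  shows "occ p (mirror w) = occ (rev p) w"
proof -
  have "occ p (mirror w) = (\<Sum>us\<in>instances p (set w). chains us (normalize (rev (runs w))))"
    by (simp add: occ_eq_sum_chains[OF assms] set_mirror runs_mirror)
  also have "\<dots> = (\<Sum>us\<in>instances p (set w). chains us (rev (runs w)))"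
    by (rule sum.cong[OF refl], rule chains_normalize, rule instances_overlap[OF _ assms(1,3)])
  also have "\<dots> = (\<Sum>us\<in>instances p (set w). chains (rev us) (runs w))"
    using chains_rev[of _ "rev (runs w)"] by simp
  also have "\<dots> = (\<Sum>us\<in>instances (rev p) (set w). chains us (runs w))"
    unfolding instances_rev by (subst sum.reindex) (auto intro: inj_onI)
  also have "\<dots> = occ (rev p) w"
    by (rule occ_eq_sum_chains[symmetric])
      (use assms in \<open>auto simp: connected_pattern_rev piecewise_decreasing_def\<close>)
  finally show ?thesis .
qed

section \<open>Reversal of words\<close>

text \<open>The gap between indices \<open>t\<close> and \<open>t + 1\<close> becomes the gap after
  index \<open>n - 2 - t\<close>, where \<open>n\<close> is the length of the pattern;
  \<open>k\<close> blocks before a dash become \<open>length p - k\<close>.\<close>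

lemma dash_after_reversal:
  assumes "dash_after p t" "Suc t < length (concat p)"
  shows "dash_after (map rev (rev p)) (length (concat p) - 2 - t)"
proof -
  obtain k where k: "0 < k" "k < length p" "Suc t = length (concat (take k p))"
    using assms unfolding dash_after_def by auto
  have "length (concat p) = Suc t + length (concat (drop k p))"
    using k(3) by (metis append_take_drop_id concat_append length_append)
  moreover have "take (length p - k) (map rev (rev p)) = map rev (rev (drop k p))"
    by (simp add: rev_drop take_map)
  then have "concat (take (length p - k) (map rev (rev p))) = rev (concat (drop k p))"
    by (simp add: rev_concat)
  ultimately have "Suc (length (concat p) - 2 - t) = length (concat (take (length p - k) (map rev (rev p))))"
    using assms(2) by (simp del: length_concat)
  then show ?thesis using k(1,2) unfolding dash_after_def by (intro exI[of _ "length p - k"]) auto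
qed

text \<open>Reflecting the positions maps occurrences injectively to occurrences. An inequality
  suffices, because applying it again to the reversed data gives the converse.\<close>

lemma occ_reversal_le: "occ p w \<le> occ (map rev (rev p)) (rev w)"
proof -
  let ?q = "map rev (rev p)" and ?n = "length w"
  let ?g = "\<lambda>js. map (\<lambda>j. ?n - Suc j) (rev js)"
  have cq: "concat ?q = rev (concat p)" by (simp add: rev_concat)
  have fin: "finite (occurrences ?q (rev w))"
    by (rule finite_subset[of _ "{js. set js \<subseteq> {..<?n} \<and> length js = length (concat ?q)}"])
      (auto simp: occurrences_def finite_lists_length_eq)
  have inj: "inj_on ?g (occurrences p w)"
  proof (rule inj_onI)
    fix xs ys assume *: "xs \<in> occurrences p w" "ys \<in> occurrences p w" "?g xs = ?g ys"
    have "set xs \<subseteq> {..<?n}" "set ys \<subseteq> {..<?n}" using * by (auto simp: occurrences_def)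
    then have "j < ?n" if "j \<in> set (rev xs) \<union> set (rev ys)" for j
      using that by auto
    moreover have "j = k" if "?n - Suc j = ?n - Suc k" "j < ?n" "k < ?n" for j k
      using that by linarith
    ultimately have "inj_on (\<lambda>j. ?n - Suc j) (set (rev xs) \<union> set (rev ys))"
      by (intro inj_onI) blast
    then have "rev xs = rev ys" using *(3) by (metis map_inj_on)
    then show "xs = ys" by simp
  qed
  have img: "?g js \<in> occurrences ?q (rev w)" if js: "js \<in> occurrences p w" for js
  proof -
    let ?m = "length js"
    have m: "length (concat p) = ?m" "sorted_wrt (<) js" "set js \<subseteq> {..<?n}"
      "\<And>s t. s < ?m \<Longrightarrow> t < ?m \<Longrightarrow> w ! (js ! s) > w ! (js ! t) \<longleftrightarrow> concat p ! s > concat p ! t"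
      "\<And>s. Suc s < ?m \<Longrightarrow> \<not> dash_after p s \<Longrightarrow> js ! Suc s = Suc (js ! s)"
      using js by (auto simp: occurrences_def)
    have lt: "js ! s < ?n" if "s < ?m" for s using m(3) that nth_mem by fastforce
    have nth: "?g js ! s = ?n - Suc (js ! (?m - Suc s))" if "s < ?m" for s
      using that by (simp add: rev_nth)
    have nthw: "rev w ! (?g js ! s) = w ! (js ! (?m - Suc s))" if "s < ?m" for s
    proof -
      have "js ! (?m - Suc s) < ?n" using lt[of "?m - Suc s"] that by simp
      then show ?thesis using nth[OF that] by (simp add: rev_nth)
    qed
    have len: "length (?g js) = ?m" by simp
    have sorted: "sorted_wrt (\<lambda>x y. ?n - Suc y < ?n - Suc x) js"
      by (rule sorted_wrt_mono_rel[OF _ m(2)]) (use m(3) in auto)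
    show ?thesis
      unfolding occurrences_def mem_Collect_eq len
    proof (intro conjI allI impI)
      show "?m = length (concat ?q)" using m(1) unfolding cq by simp
      show "sorted_wrt (<) (?g js)" using sorted by (simp add: sorted_wrt_map sorted_wrt_rev)
      show "set (?g js) \<subseteq> {..<length (rev w)}" using m(3) by auto
    next
      fix s t assume st: "s < ?m" "t < ?m"
      have "concat ?q ! i = concat p ! (?m - Suc i)" if "i < ?m" for i
        using that m(1) unfolding cq by (simp add: rev_nth)
      then show "rev w ! (?g js ! s) > rev w ! (?g js ! t) \<longleftrightarrow> concat ?q ! s > concat ?q ! t"
        using st m(4)[of "?m - Suc s" "?m - Suc t"] nthw[of s] nthw[of t] by (simp only:)
    next
      fix s assume "Suc s < ?m \<and> \<not> dash_after ?q s"
      then have s: "Suc s < ?m" "\<not> dash_after ?q s" by auto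
      \<comment> \<open>The gap after index \<open>s\<close> of the reflected list is the reflection
        of the gap after \<open>?t\<close> in \<open>js\<close>.\<close>
      let ?t = "?m - 2 - s"
      have t: "Suc ?t = ?m - Suc s" "?m - Suc (Suc s) = ?t" "?m - 2 - ?t = s" "Suc ?t < ?m"
        using s(1) by auto
      have "\<not> dash_after p ?t"
        using dash_after_reversal[of p ?t] s(2) t(4) unfolding m(1) t(3) by blast
      then have next_eq: "js ! Suc ?t = Suc (js ! ?t)" using m(5)[OF t(4)] by blast
      have "?g js ! Suc s = ?n - Suc (js ! ?t)" using nth[OF s(1)] unfolding t(2) .
      moreover have "?g js ! s = ?n - Suc (Suc (js ! ?t))"
        using nth[of s] s(1) unfolding t(1)[symmetric] next_eq by linarith
      moreover have "Suc (js ! ?t) < ?n" using lt[OF t(4)] unfolding next_eq .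
      ultimately show "?g js ! Suc s = Suc (?g js ! s)" by (simp only: Suc_diff_Suc)
    qed
  qed
  show ?thesis unfolding occ_def
    by (rule card_inj_on_le[OF inj _ fin]) (rule image_subsetI, rule img)
qed

lemma occ_reversal: "occ (map rev (rev p)) (rev w) = occ p w"
proof (rule antisym)
  have "map rev (rev (map rev (rev p))) = p" by (simp add: rev_map[symmetric] comp_def)
  then show "occ (map rev (rev p)) (rev w) \<le> occ p w"
    using occ_reversal_le[of "map rev (rev p)" "rev w"] by simp
qed (rule occ_reversal_le)

section \<open>Transfer to equidistribution over the collection\<close>

lemma mirror_mem:
  assumes "F \<subseteq> pos_words" "run_complete F" "w \<in> F"
  shows "mirror w \<in> F"
proof -
  let ?M = "descending_runs w"
  have w: "w \<in> pos_words" using assms by auto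
  have "D \<noteq> [] \<and> D \<in> pos_words \<and> decreasing D" if "D \<in># ?M" for D
  proof -
    have D: "D \<in> set (runs w)" using that by (simp add: descending_runs_eq)
    then have "set D \<subseteq> set w" using concat_runs[of w] by (metis concat_runs UN_upper set_concat)
    then show ?thesis using D w run_list_runs[of w] by (auto simp: run_list_def pos_words_def lists_eq_set)
  qed
  then have "words_with_runs ?M \<subseteq> F \<or> words_with_runs ?M \<inter> F = {}"
    using assms(2) unfolding run_complete_def by blast
  moreover have "w \<in> words_with_runs ?M" "mirror w \<in> words_with_runs ?M"
    using w by (auto simp: words_with_runs_def descending_runs_mirror pos_words_def lists_eq_set set_mirror)
  ultimately show ?thesis using assms(3) by blast
qed

lemma same_distribution_involution:
  assumes "\<And>w. w \<in> A \<Longrightarrow> h w \<in> A" "\<And>w. h (h w) = w" "\<And>w. f (h w) = g w"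
  shows "same_distribution A f g"
  unfolding same_distribution_def
proof
  fix k
  have "bij_betw h {w \<in> A. g w = k} {w \<in> A. f w = k}"
    by (rule bij_betw_byWitness[where f' = h]) (use assms in \<open>auto, metis assms(2,3)\<close>)
  then show "card {w \<in> A. f w = k} = card {w \<in> A. g w = k}"
    by (simp add: bij_betw_same_card)
qed

theorem theorem1p4:
  fixes F :: "nat list set" and ps :: "dpattern list"
  assumes "F \<subseteq> pos_words"
    and "run_complete F"
    and "\<And>n. finite (of_length F n)"
    and "\<And>p. p \<in> set ps \<Longrightarrow>
           dashed_pattern p \<and> piecewise_decreasing p \<and> connected_pattern p"
  shows "equidistributed_on F ps (map reverse_blocks ps) \<and>
    (\<forall>i<length ps. \<forall>n.
       same_distribution (of_length F n)
         (\<lambda>w. (occ (ps ! i) w, occ (reverse_blocks (ps ! i)) w))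
         (\<lambda>w. (occ (reverse_blocks (ps ! i)) w, occ (ps ! i) w))) \<and>
    (reverse_complete F \<longrightarrow>
       equidistributed_on F ps (map reverse_within_blocks ps))"
proof (intro conjI allI impI)
  have mem: "mirror w \<in> of_length F n" if "w \<in> of_length F n" for w n
    using that mirror_mem[OF assms(1,2)] by (simp add: of_length_def length_mirror)
  have occ: "occ p (mirror w) = occ (rev p) w" if "p \<in> set ps" for p w
    using assms(4)[OF that] by (intro occ_mirror) (auto simp: dashed_pattern_def)
  have vec: "vec_occ ps (mirror w) = vec_occ (map reverse_blocks ps) w" for w
    using occ by (simp add: vec_occ_def reverse_blocks_def)
  show R: "equidistributed_on F ps (map reverse_blocks ps)"
    unfolding equidistributed_on_def
    using same_distribution_involution[of _ mirror] mem mirror_mirror vec by blast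
  show "same_distribution (of_length F n)
         (\<lambda>w. (occ (ps ! i) w, occ (reverse_blocks (ps ! i)) w))
         (\<lambda>w. (occ (reverse_blocks (ps ! i)) w, occ (ps ! i) w))" if "i < length ps" for i n
  proof (rule same_distribution_involution[of _ mirror])
    fix w
    \<comment> \<open>The exchange at \<open>mirror w\<close> instead of \<open>w\<close>, combined
      with the involution property, gives the other coordinate.\<close>
    have "occ (rev (ps ! i)) (mirror w) = occ (ps ! i) w"
      using occ[of "ps ! i" "mirror w"] that by (simp add: mirror_mirror)
    then show "(occ (ps ! i) (mirror w), occ (reverse_blocks (ps ! i)) (mirror w)) =
        (occ (reverse_blocks (ps ! i)) w, occ (ps ! i) w)"
      using occ[of "ps ! i" w] that by (simp add: reverse_blocks_def)
  qed (auto simp: mem mirror_mirror)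
  show "equidistributed_on F ps (map reverse_within_blocks ps)" if rc: "reverse_complete F"
  proof -
    \<comment> \<open>Reversal of words leads from \<open>R p\<close> to
      \<open>\<langle>r|p\<rangle>\<close>; composing with \<open>R\<close> then gives the
      claim.\<close>
    have "same_distribution (of_length F n) (vec_occ (map reverse_blocks ps))
        (vec_occ (map reverse_within_blocks ps))" for n
    proof (rule same_distribution_involution[of _ rev])
      fix w
      show "w \<in> of_length F n \<Longrightarrow> rev w \<in> of_length F n"
        using rc by (simp add: reverse_complete_def of_length_def)
      show "vec_occ (map reverse_blocks ps) (rev w) = vec_occ (map reverse_within_blocks ps) w"
        \<comment> \<open>For the pattern \<open>rev p\<close> the two reversals of the block order
          cancel and \<open>map rev p\<close> remains.\<close>
        using occ_reversal[of "rev _" "rev w"]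
        by (simp add: vec_occ_def reverse_blocks_def reverse_within_blocks_def)
    qed simp
    then show ?thesis
      using R by (simp add: equidistributed_on_def same_distribution_def)
  qed
qed

end
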